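(* Let $R$ be a ring and let $M$ be a non-zero left $R$-module satisfying condition $(\ast\ast)$: for every proper fully invariant submodule $K$ of $M$, $\mathrm{Ann}_R(K)\nsubseteq\mathrm{Ann}_R(M)$. Suppose that at least one of the following holds: (1) $M$ is $fi$-coretractable; (2) $R$ is commutative. Then the following statements are equivalent: (a) $M$ is coprime. (b) $M$ is endo-coprime. (c) $M$ is fully coprime. (d) For every left ideal $I$ of $R$ either $IM=0$ or $IM=M$. (e) $\mathrm{Ann}_R(M)$ is a prime ideal of $R$.
   Context: Rings are associative with non-zero identity and modules are unital. Let $S=\mathrm{End}_R(M)$. A submodule $K$ of $M$ is fully invariant if every $f\in S$ maps $K$ into $K$. $M$ is coprime if for every proper fully invariant submodule $K$ of $M$, $\mathrm{Ann}_R(M/K)=\mathrm{Ann}_R(M)$ (equivalently, for every proper submodule $K$). $M$ is endo-coprime if for every proper fully invariant submodule $K$ of $M$, the only $f\in S$ with $f(M)\subseteq K$ is $f=0$. $M$ is $fi$-coretractable if for every proper fully invariant submodule $K$ of $M$ there is a non-zero $f\in S$ with $f(K)=0$. $M$ is fully coprime if for every proper fully invariant submodule $K$ of $M$, $M$ is $M/K$-generated (a homomorphic image of a direct sum of copies of $M/K$). *)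

theory Defs
  imports "HOL-Algebra.Module" "HOL-Algebra.Ideal_Product"
begin

section \<open>Left modules over arbitrary rings\<close>

text \<open>
  The locale \<open>module\<close> of HOL-Algebra is restricted to commutative rings. The locale below has the
  same axioms over an arbitrary (associative, unital) ring and uses the same record type.
\<close>

locale left_module = R?: ring R + M?: abelian_group M
  for R :: "('r, 'p) ring_scheme" (structure) and M :: "('r, 'm, 'q) module_scheme" (structure) +
  assumes smult_closed [simp, intro]:
      "\<lbrakk>a \<in> carrier R; x \<in> carrier M\<rbrakk> \<Longrightarrow> a \<odot>\<^bsub>M\<^esub> x \<in> carrier M"
    and smult_l_distr:
      "\<lbrakk>a \<in> carrier R; b \<in> carrier R; x \<in> carrier M\<rbrakk>
        \<Longrightarrow> (a \<oplus> b) \<odot>\<^bsub>M\<^esub> x = a \<odot>\<^bsub>M\<^esub> x \<oplus>\<^bsub>M\<^esub> b \<odot>\<^bsub>M\<^esub> x"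
    and smult_r_distr:
      "\<lbrakk>a \<in> carrier R; x \<in> carrier M; y \<in> carrier M\<rbrakk>
        \<Longrightarrow> a \<odot>\<^bsub>M\<^esub> (x \<oplus>\<^bsub>M\<^esub> y) = a \<odot>\<^bsub>M\<^esub> x \<oplus>\<^bsub>M\<^esub> a \<odot>\<^bsub>M\<^esub> y"
    and smult_assoc1:
      "\<lbrakk>a \<in> carrier R; b \<in> carrier R; x \<in> carrier M\<rbrakk>
        \<Longrightarrow> (a \<otimes> b) \<odot>\<^bsub>M\<^esub> x = a \<odot>\<^bsub>M\<^esub> (b \<odot>\<^bsub>M\<^esub> x)"
    and smult_one [simp]: "x \<in> carrier M \<Longrightarrow> \<one> \<odot>\<^bsub>M\<^esub> x = x"

lemma module_iff_left_module: "module R M \<longleftrightarrow> cring R \<and> left_module R M"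
  by (auto simp: module_def left_module_def module_axioms_def left_module_axioms_def
      dest: cring.axioms(1))

text \<open>
  Homomorphisms are HOL functions, so only their values on the carrier matter; accordingly
  \<open>f = 0\<close> is always rendered as \<open>f x = 0\<close> for all \<open>x\<close> in the carrier.
\<close>

definition left_module_hom ::
    "('r, 'p) ring_scheme \<Rightarrow> ('r, 'm, 'q) module_scheme \<Rightarrow> ('r, 'n, 's) module_scheme \<Rightarrow> ('m \<Rightarrow> 'n) set"
  where "left_module_hom R M N =
    {f \<in> hom (add_monoid M) (add_monoid N).
      \<forall>r\<in>carrier R. \<forall>x\<in>carrier M. f (r \<odot>\<^bsub>M\<^esub> x) = r \<odot>\<^bsub>N\<^esub> f x}"

abbreviation left_module_End ::
    "('r, 'p) ring_scheme \<Rightarrow> ('r, 'm, 'q) module_scheme \<Rightarrow> ('m \<Rightarrow> 'm) set"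
  where "left_module_End R M \<equiv> left_module_hom R M M"

definition fully_invariant ::
    "('r, 'p) ring_scheme \<Rightarrow> ('r, 'm, 'q) module_scheme \<Rightarrow> 'm set \<Rightarrow> bool"
  where "fully_invariant R M K \<longleftrightarrow>
    submodule K R M \<and> (\<forall>f\<in>left_module_End R M. f ` K \<subseteq> K)"

definition proper_fully_invariant ::
    "('r, 'p) ring_scheme \<Rightarrow> ('r, 'm, 'q) module_scheme \<Rightarrow> 'm set \<Rightarrow> bool"
  where "proper_fully_invariant R M K \<longleftrightarrow> fully_invariant R M K \<and> K \<noteq> carrier M"

definition annihilator ::
    "('r, 'p) ring_scheme \<Rightarrow> ('r, 'm, 'q) module_scheme \<Rightarrow> 'm set \<Rightarrow> 'r set"
  where "annihilator R M X = {r \<in> carrier R. \<forall>x\<in>X. r \<odot>\<^bsub>M\<^esub> x = \<zero>\<^bsub>M\<^esub>}"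

abbreviation Ann :: "('r, 'p) ring_scheme \<Rightarrow> ('r, 'm, 'q) module_scheme \<Rightarrow> 'r set"
  where "Ann R M \<equiv> annihilator R M (carrier M)"

text \<open>
  The record type of modules extends that of rings, so every module carries two fields
  \<open>mult\<close> and \<open>one\<close> that are meaningless for modules; they are left unspecified below.
  Scalar multiplication on cosets is \<open>r (K + x) = K + r x\<close>, written in the style of the
  library's \<open>rcoset_mult\<close>.
\<close>

definition quotient_module ::
    "('r, 'm, 'q) module_scheme \<Rightarrow> 'm set \<Rightarrow> ('r, 'm set) module"
  where "quotient_module M K =
    \<lparr>carrier = a_rcosets\<^bsub>M\<^esub> K, mult = undefined, one = undefined,
     zero = K, add = set_add M, smult = (\<lambda>r X. \<Union>x\<in>X. K +>\<^bsub>M\<^esub> (r \<odot>\<^bsub>M\<^esub> x))\<rparr>"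

lemma (in left_module) submodule_abelian_subgroup:
  assumes "submodule K R M"
  shows "abelian_subgroup K M"
  using assms M.abelian_group_axioms
  by (auto intro!: abelian_subgroupI3 additive_subgroup.intro dest: submodule.axioms(1))

lemma (in left_module) smult_zero_right:
  assumes "a \<in> carrier R"
  shows "a \<odot>\<^bsub>M\<^esub> \<zero>\<^bsub>M\<^esub> = \<zero>\<^bsub>M\<^esub>"
  using smult_r_distr[OF assms, of "\<zero>\<^bsub>M\<^esub>" "\<zero>\<^bsub>M\<^esub>"] assms
  by (metis M.add.r_cancel_one' M.zero_closed M.r_zero smult_closed)

lemma (in left_module) smult_coset:
  assumes K: "submodule K R M" and r: "r \<in> carrier R" and x: "x \<in> carrier M"
  shows "r \<odot>\<^bsub>quotient_module M K\<^esub> (K +>\<^bsub>M\<^esub> x) = K +>\<^bsub>M\<^esub> (r \<odot>\<^bsub>M\<^esub> x)"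
proof -
  interpret K: abelian_subgroup K M by (rule submodule_abelian_subgroup[OF K])
  have "K +>\<^bsub>M\<^esub> (r \<odot>\<^bsub>M\<^esub> y) = K +>\<^bsub>M\<^esub> (r \<odot>\<^bsub>M\<^esub> x)" if y: "y \<in> K +>\<^bsub>M\<^esub> x" for y
  proof -
    obtain k where k: "k \<in> K" "y = k \<oplus>\<^bsub>M\<^esub> x"
      using y by (auto simp: a_r_coset_def r_coset_def)
    have "k \<in> carrier M" using k(1) by (rule K.a_Hcarr)
    then have "r \<odot>\<^bsub>M\<^esub> y = r \<odot>\<^bsub>M\<^esub> k \<oplus>\<^bsub>M\<^esub> r \<odot>\<^bsub>M\<^esub> x"
      using k(2) r x by (simp add: smult_r_distr)
    moreover have "r \<odot>\<^bsub>M\<^esub> k \<in> K" using K r k(1) by (rule submodule.smult_closed)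
    ultimately have "r \<odot>\<^bsub>M\<^esub> y \<in> K +>\<^bsub>M\<^esub> (r \<odot>\<^bsub>M\<^esub> x)"
      by (auto simp: a_r_coset_def r_coset_def)
    then have "K +>\<^bsub>M\<^esub> (r \<odot>\<^bsub>M\<^esub> x) = K +>\<^bsub>M\<^esub> (r \<odot>\<^bsub>M\<^esub> y)"
      using smult_closed[OF r x] by (rule K.a_repr_independence')
    then show ?thesis by (rule sym)
  qed
  moreover have "x \<in> K +>\<^bsub>M\<^esub> x" using x by (rule K.a_rcos_self)
  ultimately have "(\<Union>y\<in>K +>\<^bsub>M\<^esub> x. K +>\<^bsub>M\<^esub> (r \<odot>\<^bsub>M\<^esub> y)) = K +>\<^bsub>M\<^esub> (r \<odot>\<^bsub>M\<^esub> x)"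
    by blast
  then show ?thesis by (simp add: quotient_module_def)
qed

lemma (in left_module) quotient_left_module:
  assumes K: "submodule K R M"
  shows "left_module R (quotient_module M K)"
proof -
  interpret K: abelian_subgroup K M by (rule submodule_abelian_subgroup[OF K])
  have carr: "X \<in> carrier (quotient_module M K) \<longleftrightarrow> (\<exists>x\<in>carrier M. X = K +>\<^bsub>M\<^esub> x)" for X
    by (auto simp: quotient_module_def A_RCOSETS_def')
  have add: "(K +>\<^bsub>M\<^esub> x) \<oplus>\<^bsub>quotient_module M K\<^esub> (K +>\<^bsub>M\<^esub> y) = K +>\<^bsub>M\<^esub> (x \<oplus>\<^bsub>M\<^esub> y)"
    if "x \<in> carrier M" "y \<in> carrier M" for x y
    using that by (simp add: quotient_module_def K.a_rcos_sum)
  have zero: "\<zero>\<^bsub>quotient_module M K\<^esub> = K +>\<^bsub>M\<^esub> \<zero>\<^bsub>M\<^esub>"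
    using M.a_coset_add_zero[OF K.a_subset] by (simp add: quotient_module_def)
  have ag: "abelian_group (quotient_module M K)"
  proof (rule abelian_groupI)
    fix X assume "X \<in> carrier (quotient_module M K)"
    then obtain x where x: "x \<in> carrier M" "X = K +>\<^bsub>M\<^esub> x" by (auto simp: carr)
    then have "(K +>\<^bsub>M\<^esub> (\<ominus>\<^bsub>M\<^esub> x)) \<oplus>\<^bsub>quotient_module M K\<^esub> X = \<zero>\<^bsub>quotient_module M K\<^esub>"
      by (simp add: add zero M.l_neg)
    then show "\<exists>Y\<in>carrier (quotient_module M K).
        Y \<oplus>\<^bsub>quotient_module M K\<^esub> X = \<zero>\<^bsub>quotient_module M K\<^esub>"
      using x by (meson M.a_inv_closed carr)
  qed (auto simp: carr add zero M.a_ac)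
  show ?thesis
    by (intro left_module.intro left_module_axioms.intro R.ring_axioms ag)
      (auto simp: carr smult_coset[OF K] add smult_l_distr smult_r_distr smult_assoc1)
qed

definition direct_power ::
    "'i set \<Rightarrow> ('r, 'n, 's) module_scheme \<Rightarrow> ('r, 'i \<Rightarrow> 'n) module"
  where "direct_power I N =
    \<lparr>carrier = {x \<in> I \<rightarrow>\<^sub>E carrier N. finite {i \<in> I. x i \<noteq> \<zero>\<^bsub>N\<^esub>}},
     mult = undefined, one = undefined,
     zero = (\<lambda>i\<in>I. \<zero>\<^bsub>N\<^esub>), add = (\<lambda>x y. \<lambda>i\<in>I. x i \<oplus>\<^bsub>N\<^esub> y i),
     smult = (\<lambda>r x. \<lambda>i\<in>I. r \<odot>\<^bsub>N\<^esub> x i)\<rparr>"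

text \<open>
  HOL cannot quantify over the type of the index set. Using sets of functions \<open>N \<Rightarrow> M\<close> as
  index sets loses nothing: \<open>generated_byI\<close> below shows that an index set of any
  type may be used.
\<close>

definition generated_by ::
    "('r, 'p) ring_scheme \<Rightarrow> ('r, 'n, 's) module_scheme \<Rightarrow> ('r, 'm, 'q) module_scheme \<Rightarrow> bool"
  where "generated_by R N M \<longleftrightarrow>
    (\<exists>I :: ('n \<Rightarrow> 'm) set. \<exists>h\<in>left_module_hom R (direct_power I N) M.
      h ` carrier (direct_power I N) = carrier M)"

lemma generated_byI:
  fixes I :: "'i set" and M :: "('r, 'm, 'q) module_scheme" and N :: "('r, 'n, 's) module_scheme"
  assumes "left_module R N" "left_module R M"
    and h: "h \<in> left_module_hom R (direct_power I N) M"
    and surj: "h ` carrier (direct_power I N) = carrier M"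
  shows "generated_by R N M"
proof -
  interpret N: left_module R N by fact
  interpret M: left_module R M by fact
  define D where "D = carrier (direct_power I N)"
  have D_iff: "x \<in> D \<longleftrightarrow> x \<in> I \<rightarrow>\<^sub>E carrier N \<and> finite {i \<in> I. x i \<noteq> \<zero>\<^bsub>N\<^esub>}" for x
    by (simp add: D_def direct_power_def)
  have h_closed: "h x \<in> carrier M" if "x \<in> D" for x
    using h that by (auto simp: left_module_hom_def hom_def D_def)
  have h_add: "h (\<lambda>i\<in>I. x i \<oplus>\<^bsub>N\<^esub> y i) = h x \<oplus>\<^bsub>M\<^esub> h y" if "x \<in> D" "y \<in> D" for x y
    using h that by (auto simp: left_module_hom_def hom_def D_def direct_power_def)
  have h_smult: "h (\<lambda>i\<in>I. r \<odot>\<^bsub>N\<^esub> x i) = r \<odot>\<^bsub>M\<^esub> h x" if "r \<in> carrier R" "x \<in> D" for r x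
    using h that by (auto simp: left_module_hom_def D_def direct_power_def)
  define e where "e i n = (\<lambda>k\<in>I. if k = i then n else \<zero>\<^bsub>N\<^esub>)" for i n
  have e_D: "e i n \<in> D" if "i \<in> I" "n \<in> carrier N" for i n
  proof -
    have "{k \<in> I. e i n k \<noteq> \<zero>\<^bsub>N\<^esub>} \<subseteq> {i}" by (auto simp: e_def)
    then have "finite {k \<in> I. e i n k \<noteq> \<zero>\<^bsub>N\<^esub>}"
      by (rule finite_subset) simp
    moreover have "e i n \<in> I \<rightarrow>\<^sub>E carrier N" using that by (auto simp: e_def)
    ultimately show ?thesis by (simp add: D_iff)
  qed
  text \<open>The components of \<open>h\<close>, and one index for each distinct component.\<close>
  define F where "F i = (\<lambda>n\<in>carrier N. h (e i n))" for i
  define J where "J = F ` I"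
  define s where "s = inv_into I F"
  have s: "s j \<in> I" "F (s j) = j" if "j \<in> J" for j
    using that by (auto simp: J_def s_def inv_into_into f_inv_into_f)
  define t where "t y = (\<lambda>i\<in>I. if i = s (F i) then y (F i) else \<zero>\<^bsub>N\<^esub>)" for y :: "('n \<Rightarrow> 'm) \<Rightarrow> 'n"
  define DJ where "DJ = carrier (direct_power J N)"
  have DJ_iff: "y \<in> DJ \<longleftrightarrow> y \<in> J \<rightarrow>\<^sub>E carrier N \<and> finite {j \<in> J. y j \<noteq> \<zero>\<^bsub>N\<^esub>}" for y
    by (simp add: DJ_def direct_power_def)
  have FJ: "F i \<in> J" if "i \<in> I" for i using that by (simp add: J_def)
  have t_D: "t y \<in> D" if y: "y \<in> DJ" for y
  proof -
    have "{i \<in> I. t y i \<noteq> \<zero>\<^bsub>N\<^esub>} \<subseteq> s ` {j \<in> J. y j \<noteq> \<zero>\<^bsub>N\<^esub>}"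
      using FJ by (auto simp: t_def split: if_splits)
    then have "finite {i \<in> I. t y i \<noteq> \<zero>\<^bsub>N\<^esub>}"
      by (rule finite_subset) (use y in \<open>simp add: DJ_iff\<close>)
    moreover have "t y \<in> I \<rightarrow>\<^sub>E carrier N"
      using y FJ by (auto simp: DJ_iff t_def)
    ultimately show ?thesis by (simp add: D_iff)
  qed
  have t_add: "t (\<lambda>j\<in>J. y j \<oplus>\<^bsub>N\<^esub> z j) = (\<lambda>i\<in>I. t y i \<oplus>\<^bsub>N\<^esub> t z i)" for y z
    by (rule ext) (auto simp: t_def FJ)
  have t_smult: "t (\<lambda>j\<in>J. r \<odot>\<^bsub>N\<^esub> y j) = (\<lambda>i\<in>I. r \<odot>\<^bsub>N\<^esub> t y i)" if "r \<in> carrier R" for r y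
    by (rule ext) (auto simp: t_def FJ N.smult_zero_right that)
  define g where "g = h \<circ> t"
  have add_DJ: "(\<lambda>j\<in>J. y j \<oplus>\<^bsub>N\<^esub> z j) \<in> DJ" if "y \<in> DJ" "z \<in> DJ" for y z
  proof -
    have "{j \<in> J. (\<lambda>j\<in>J. y j \<oplus>\<^bsub>N\<^esub> z j) j \<noteq> \<zero>\<^bsub>N\<^esub>}
        \<subseteq> {j \<in> J. y j \<noteq> \<zero>\<^bsub>N\<^esub>} \<union> {j \<in> J. z j \<noteq> \<zero>\<^bsub>N\<^esub>}" by auto
    then have "finite {j \<in> J. (\<lambda>j\<in>J. y j \<oplus>\<^bsub>N\<^esub> z j) j \<noteq> \<zero>\<^bsub>N\<^esub>}"
      by (rule finite_subset) (use that in \<open>simp add: DJ_iff\<close>)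
    moreover have "(\<lambda>j\<in>J. y j \<oplus>\<^bsub>N\<^esub> z j) \<in> J \<rightarrow>\<^sub>E carrier N"
      using that by (auto simp: DJ_iff PiE_def Pi_def)
    ultimately show ?thesis unfolding DJ_iff by blast
  qed
  have g_hom: "g \<in> left_module_hom R (direct_power J N) M"
    unfolding left_module_hom_def hom_def
    using h_closed t_D h_add h_smult t_add t_smult
    by (auto simp: g_def DJ_def[symmetric]) (auto simp: direct_power_def)
  have g_add: "g (\<lambda>j\<in>J. y j \<oplus>\<^bsub>N\<^esub> z j) = g y \<oplus>\<^bsub>M\<^esub> g z" if "y \<in> DJ" "z \<in> DJ" for y z
    using that h_add t_D by (simp add: g_def t_add)
  have e_img: "h (e i n) \<in> g ` DJ" if i: "i \<in> I" and n: "n \<in> carrier N" for i n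
  proof -
    define y where "y = (\<lambda>j\<in>J. if j = F i then n else \<zero>\<^bsub>N\<^esub>)"
    have "{j \<in> J. y j \<noteq> \<zero>\<^bsub>N\<^esub>} \<subseteq> {F i}" by (auto simp: y_def)
    then have "finite {j \<in> J. y j \<noteq> \<zero>\<^bsub>N\<^esub>}"
      by (rule finite_subset) simp
    moreover have "y \<in> J \<rightarrow>\<^sub>E carrier N" using n by (auto simp: y_def)
    ultimately have y: "y \<in> DJ" by (simp add: DJ_iff)
    have "k = s (F k) \<and> F k = F i \<longleftrightarrow> k = s (F i)" for k
      using s(2)[OF FJ[OF i]] by metis
    then have "t y k = e (s (F i)) n k" for k
      using FJ[of k] by (auto simp: t_def y_def e_def simp del: fun_eq_iff)
    then have "t y = e (s (F i)) n" by (rule ext)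
    then have "g y = F (s (F i)) n" using n by (simp add: g_def F_def)
    also have "\<dots> = h (e i n)" using s(2)[OF FJ[OF i]] n by (simp add: F_def)
    finally show ?thesis using y by force
  qed
  have zero_img: "h (\<lambda>i\<in>I. \<zero>\<^bsub>N\<^esub>) \<in> g ` DJ"
  proof -
    have "t (\<lambda>j\<in>J. \<zero>\<^bsub>N\<^esub>) = (\<lambda>i\<in>I. \<zero>\<^bsub>N\<^esub>)" by (rule ext) (auto simp: t_def FJ)
    moreover have "(\<lambda>j\<in>J. \<zero>\<^bsub>N\<^esub>) \<in> DJ" by (auto simp: DJ_iff)
    ultimately show ?thesis unfolding g_def by (metis comp_apply image_eqI)
  qed
  have "h x \<in> g ` DJ" if "finite A" "x \<in> D" "{i \<in> I. x i \<noteq> \<zero>\<^bsub>N\<^esub>} \<subseteq> A" for A x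
    using that
  proof (induction A arbitrary: x)
    case empty
    then have "x = (\<lambda>i\<in>I. \<zero>\<^bsub>N\<^esub>)" by (auto simp: D_iff fun_eq_iff PiE_def extensional_def)
    then show ?case using zero_img by (simp only:)
  next
    case (insert a A)
    show ?case
    proof (cases "a \<in> I")
      case False
      then show ?thesis using insert by (intro insert.IH) auto
    next
      case True
      define x' where "x' = (\<lambda>i\<in>I. if i = a then \<zero>\<^bsub>N\<^esub> else x i)"
      have "{i \<in> I. x' i \<noteq> \<zero>\<^bsub>N\<^esub>} \<subseteq> {i \<in> I. x i \<noteq> \<zero>\<^bsub>N\<^esub>}" by (auto simp: x'_def)
      then have "finite {i \<in> I. x' i \<noteq> \<zero>\<^bsub>N\<^esub>}"
        by (rule finite_subset) (use insert.prems(1) in \<open>simp add: D_iff\<close>)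
      moreover have "x' \<in> I \<rightarrow>\<^sub>E carrier N"
        using insert.prems(1) by (auto simp: D_iff x'_def)
      ultimately have x': "x' \<in> D" by (simp add: D_iff)
      have xa: "x a \<in> carrier N" using True insert.prems(1) by (auto simp: D_iff)
      have "(\<lambda>i\<in>I. x' i \<oplus>\<^bsub>N\<^esub> e a (x a) i) = x"
        using insert.prems(1)
        by (auto simp: D_iff x'_def e_def fun_eq_iff PiE_def Pi_def extensional_def)
      then have hx: "h x = h x' \<oplus>\<^bsub>M\<^esub> h (e a (x a))"
        using h_add[OF x' e_D[OF True xa]] by simp
      have "{i \<in> I. x' i \<noteq> \<zero>\<^bsub>N\<^esub>} \<subseteq> A" using insert.prems(2) by (auto simp: x'_def)
      with x' have "h x' \<in> g ` DJ" by (rule insert.IH)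
      then obtain y z where "y \<in> DJ" "z \<in> DJ" "h x' = g y" "h (e a (x a)) = g z"
        using e_img[OF True xa] by blast
      then show ?thesis using hx g_add[of y z] add_DJ[of y z] by (simp add: image_iff) metis
    qed
  qed
  then have "h ` D \<subseteq> g ` DJ" by (auto simp: D_iff)
  moreover have "g ` DJ \<subseteq> carrier M" using h_closed t_D by (auto simp: g_def)
  ultimately have "g ` DJ = carrier M" using surj by (auto simp: D_def)
  then show ?thesis using g_hom unfolding generated_by_def DJ_def by blast
qed


section \<open>Coprimeness conditions\<close>

definition coprime_module ::
    "('r, 'p) ring_scheme \<Rightarrow> ('r, 'm, 'q) module_scheme \<Rightarrow> bool"
  where "coprime_module R M \<longleftrightarrow>
    (\<forall>K. proper_fully_invariant R M K \<longrightarrow> Ann R (quotient_module M K) = Ann R M)"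

definition endo_coprime ::
    "('r, 'p) ring_scheme \<Rightarrow> ('r, 'm, 'q) module_scheme \<Rightarrow> bool"
  where "endo_coprime R M \<longleftrightarrow>
    (\<forall>K. proper_fully_invariant R M K \<longrightarrow>
      (\<forall>f\<in>left_module_End R M. f ` carrier M \<subseteq> K \<longrightarrow> (\<forall>x\<in>carrier M. f x = \<zero>\<^bsub>M\<^esub>)))"

definition fi_coretractable ::
    "('r, 'p) ring_scheme \<Rightarrow> ('r, 'm, 'q) module_scheme \<Rightarrow> bool"
  where "fi_coretractable R M \<longleftrightarrow>
    (\<forall>K. proper_fully_invariant R M K \<longrightarrow>
      (\<exists>f\<in>left_module_End R M. \<not> (\<forall>x\<in>carrier M. f x = \<zero>\<^bsub>M\<^esub>) \<and> (\<forall>x\<in>K. f x = \<zero>\<^bsub>M\<^esub>)))"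

definition fully_coprime ::
    "('r, 'p) ring_scheme \<Rightarrow> ('r, 'm, 'q) module_scheme \<Rightarrow> bool"
  where "fully_coprime R M \<longleftrightarrow>
    (\<forall>K. proper_fully_invariant R M K \<longrightarrow> generated_by R (quotient_module M K) M)"


section \<open>Ideals\<close>

definition left_ideal :: "'r set \<Rightarrow> ('r, 'p) ring_scheme \<Rightarrow> bool"
  where "left_ideal I R \<longleftrightarrow>
    additive_subgroup I R \<and> (\<forall>r\<in>carrier R. \<forall>a\<in>I. r \<otimes>\<^bsub>R\<^esub> a \<in> I)"

text \<open>\<open>I M\<close> is the set of finite sums of products \<open>a x\<close> with \<open>a \<in> I\<close>, \<open>x \<in> M\<close>.\<close>

definition ideal_smult :: "'r set \<Rightarrow> ('r, 'm, 'q) module_scheme \<Rightarrow> 'm set"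
  where "ideal_smult I M =
    {\<Oplus>\<^bsub>M\<^esub>k\<in>{..<n}. a k \<odot>\<^bsub>M\<^esub> x k | (n::nat) a x.
      a \<in> {..<n} \<rightarrow> I \<and> x \<in> {..<n} \<rightarrow> carrier M}"

text \<open>
  The library's \<open>primeideal\<close> is restricted to commutative rings and, being elementwise, would be
  the notion of a completely prime ideal otherwise; here the ideal-theoretic notion is needed.
\<close>

definition prime_ideal :: "'r set \<Rightarrow> ('r, 'p) ring_scheme \<Rightarrow> bool"
  where "prime_ideal P R \<longleftrightarrow>
    ideal P R \<and> P \<noteq> carrier R \<and>
    (\<forall>I J. ideal I R \<longrightarrow> ideal J R \<longrightarrow> I \<cdot>\<^bsub>R\<^esub> J \<subseteq> P \<longrightarrow> I \<subseteq> P \<or> J \<subseteq> P)"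

end

theory Submission
  imports Defs "HOL-Algebra.Free_Abelian_Groups"
begin

text \<open>
  Write \<open>(\<ast>\<ast>)\<close> for the assumption that \<open>Ann(K)\<close> is not contained in \<open>Ann(M)\<close> whenever \<open>K\<close> is a
  proper fully invariant submodule.

  The commutative case reduces to the \<open>fi\<close>-coretractable one: if \<open>r\<close> kills \<open>K\<close> but not \<open>M\<close>, then
  multiplication by \<open>r\<close> is a non-zero endomorphism killing \<open>K\<close>
  (\<open>fi_coretractable_if_commutative\<close>).

  Coprimeness says exactly that each \<open>I M\<close> is zero or all of \<open>M\<close>, because \<open>I M\<close> is fully invariant
  and \<open>I\<close> annihilates \<open>M/I M\<close> (\<open>coprime_iff_ideal_smult\<close>). This dichotomy drives everything else.
  If \<open>I J M = 0\<close> and \<open>J M \<noteq> 0\<close>, then \<open>J M = M\<close> and \<open>I M = 0\<close>, so \<open>Ann(M)\<close> is prime. Conversely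
  \<open>Ann(K) Ann(M/K)\<close> annihilates \<open>M\<close>, so primeness together with \<open>(\<ast>\<ast>)\<close> puts \<open>Ann(M/K)\<close> inside
  \<open>Ann(M)\<close>.

  The other conditions are joined in a cycle. Coprime modules are endo-coprime: if \<open>f M \<subseteq> K\<close> and
  \<open>L = Ann(K)\<close>, then \<open>L M = M\<close> by \<open>(\<ast>\<ast>)\<close>, whence \<open>f M = L (f M) = 0\<close>. Endo-coprime modules
  that are \<open>fi\<close>-coretractable are fully coprime: the sum of all images of \<open>M/K\<close> in \<open>M\<close> is fully
  invariant and contains the image of a non-zero endomorphism, so it cannot be proper
  (\<open>endo_coprime_imp_fully_coprime\<close>, \<open>generated_by_if_trace\<close>). Finally \<open>Ann(M/K)\<close> kills everything
  that is generated by \<open>M/K\<close>, so fully coprime modules are coprime.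
\<close>

section \<open>Submodules and homomorphisms\<close>

lemma left_module_homI:
  assumes "\<And>x. x \<in> carrier M \<Longrightarrow> f x \<in> carrier N"
    and "\<And>x y. x \<in> carrier M \<Longrightarrow> y \<in> carrier M \<Longrightarrow> f (x \<oplus>\<^bsub>M\<^esub> y) = f x \<oplus>\<^bsub>N\<^esub> f y"
    and "\<And>r x. r \<in> carrier R \<Longrightarrow> x \<in> carrier M \<Longrightarrow> f (r \<odot>\<^bsub>M\<^esub> x) = r \<odot>\<^bsub>N\<^esub> f x"
  shows "f \<in> left_module_hom R M N"
  using assms by (auto simp: left_module_hom_def hom_def)

lemma left_module_homD:
  assumes "f \<in> left_module_hom R M N"
  shows "x \<in> carrier M \<Longrightarrow> f x \<in> carrier N"
    and "x \<in> carrier M \<Longrightarrow> y \<in> carrier M \<Longrightarrow> f (x \<oplus>\<^bsub>M\<^esub> y) = f x \<oplus>\<^bsub>N\<^esub> f y"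
    and "r \<in> carrier R \<Longrightarrow> x \<in> carrier M \<Longrightarrow> f (r \<odot>\<^bsub>M\<^esub> x) = r \<odot>\<^bsub>N\<^esub> f x"
  using assms by (auto simp: left_module_hom_def hom_def)

lemma left_module_hom_comp:
  assumes "f \<in> left_module_hom R M N" "g \<in> left_module_hom R N P"
  shows "g \<circ> f \<in> left_module_hom R M P"
  by (rule left_module_homI) (simp_all add: left_module_homD[OF assms(1)] left_module_homD[OF assms(2)])

lemma submoduleD:
  assumes "submodule U R M"
  shows "U \<subseteq> carrier M" "\<zero>\<^bsub>M\<^esub> \<in> U"
    and "x \<in> U \<Longrightarrow> y \<in> U \<Longrightarrow> x \<oplus>\<^bsub>M\<^esub> y \<in> U"
    and "r \<in> carrier R \<Longrightarrow> x \<in> U \<Longrightarrow> r \<odot>\<^bsub>M\<^esub> x \<in> U"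
proof -
  interpret U: submodule U R M by fact
  show "U \<subseteq> carrier M" "\<zero>\<^bsub>M\<^esub> \<in> U" "x \<in> U \<Longrightarrow> y \<in> U \<Longrightarrow> x \<oplus>\<^bsub>M\<^esub> y \<in> U"
    "r \<in> carrier R \<Longrightarrow> x \<in> U \<Longrightarrow> r \<odot>\<^bsub>M\<^esub> x \<in> U"
    using U.subset U.one_closed U.m_closed U.smult_closed by auto
qed

lemma left_module_hom_zero:
  assumes "left_module R M" "left_module R N" "f \<in> left_module_hom R M N"
  shows "f \<zero>\<^bsub>M\<^esub> = \<zero>\<^bsub>N\<^esub>"
proof -
  interpret M: left_module R M by fact
  interpret N: left_module R N by fact
  have "f \<zero>\<^bsub>M\<^esub> \<oplus>\<^bsub>N\<^esub> f \<zero>\<^bsub>M\<^esub> = f \<zero>\<^bsub>M\<^esub>"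
    using left_module_homD(2)[OF assms(3), of "\<zero>\<^bsub>M\<^esub>" "\<zero>\<^bsub>M\<^esub>"] by simp
  then show ?thesis
    using left_module_homD(1)[OF assms(3), of "\<zero>\<^bsub>M\<^esub>"] N.M.add.r_cancel_one' by (metis M.M.zero_closed)
qed

context left_module
begin

lemma smult_zero_left:
  assumes "x \<in> carrier M"
  shows "\<zero>\<^bsub>R\<^esub> \<odot>\<^bsub>M\<^esub> x = \<zero>\<^bsub>M\<^esub>"
  using smult_l_distr[of "\<zero>\<^bsub>R\<^esub>" "\<zero>\<^bsub>R\<^esub>" x] assms
  by (metis M.add.r_cancel_one' R.r_zero R.zero_closed smult_closed)

lemma smult_minus_left:
  assumes "r \<in> carrier R" "x \<in> carrier M"
  shows "(\<ominus>\<^bsub>R\<^esub> r) \<odot>\<^bsub>M\<^esub> x = \<ominus>\<^bsub>M\<^esub> (r \<odot>\<^bsub>M\<^esub> x)"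
proof -
  have "(\<ominus>\<^bsub>R\<^esub> r) \<odot>\<^bsub>M\<^esub> x \<oplus>\<^bsub>M\<^esub> r \<odot>\<^bsub>M\<^esub> x = \<zero>\<^bsub>M\<^esub>"
    using assms smult_l_distr[of "\<ominus>\<^bsub>R\<^esub> r" r x] by (simp add: R.l_neg smult_zero_left)
  then show ?thesis using assms by (simp add: M.minus_equality)
qed

text \<open>Closure under negation is automatic, since \<open>- x = (-1) x\<close>.\<close>

lemma submodule_intro:
  assumes "U \<subseteq> carrier M" "\<zero>\<^bsub>M\<^esub> \<in> U"
    and "\<And>x y. x \<in> U \<Longrightarrow> y \<in> U \<Longrightarrow> x \<oplus>\<^bsub>M\<^esub> y \<in> U"
    and smult: "\<And>r x. r \<in> carrier R \<Longrightarrow> x \<in> U \<Longrightarrow> r \<odot>\<^bsub>M\<^esub> x \<in> U"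
  shows "submodule U R M"
proof -
  have "\<ominus>\<^bsub>M\<^esub> x \<in> U" if "x \<in> U" for x
  proof -
    have "(\<ominus>\<^bsub>R\<^esub> \<one>\<^bsub>R\<^esub>) \<odot>\<^bsub>M\<^esub> x \<in> U" using that by (intro smult) auto
    then show ?thesis using that assms(1) smult_minus_left[of "\<one>\<^bsub>R\<^esub>" x] by auto
  qed
  then show ?thesis
    using assms unfolding submodule_def submodule_axioms_def subgroup_def
    by (auto simp: a_inv_def)
qed

lemma submodule_preimage:
  assumes "left_module R N" "f \<in> left_module_hom R M N" "submodule U R N"
  shows "submodule {x \<in> carrier M. f x \<in> U} R M"
  using left_module_hom_zero[OF left_module_axioms assms(1,2)]
  by (intro submodule_intro)
    (auto simp: left_module_homD[OF assms(2)] submoduleD[OF assms(3)])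

lemma submodule_Inter:
  assumes "\<U> \<noteq> {}" "\<And>U. U \<in> \<U> \<Longrightarrow> submodule U R M"
  shows "submodule (\<Inter>\<U>) R M"
proof (rule submodule_intro)
  note UD = submoduleD[OF assms(2)]
  show "\<Inter>\<U> \<subseteq> carrier M" using assms(1) UD(1) by blast
  show "\<zero>\<^bsub>M\<^esub> \<in> \<Inter>\<U>" using UD(2) by simp
  show "x \<oplus>\<^bsub>M\<^esub> y \<in> \<Inter>\<U>" if "x \<in> \<Inter>\<U>" "y \<in> \<Inter>\<U>" for x y
    using that UD(3) by simp
  show "r \<odot>\<^bsub>M\<^esub> x \<in> \<Inter>\<U>" if "r \<in> carrier R" "x \<in> \<Inter>\<U>" for r x
    using that UD(4) by simp
qed

lemma submodule_carrier: "submodule (carrier M) R M"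
  by (rule submodule_intro) auto

lemma quotient_carrier_iff:
  "X \<in> carrier (quotient_module M K) \<longleftrightarrow> (\<exists>x\<in>carrier M. X = K +>\<^bsub>M\<^esub> x)"
  by (auto simp: quotient_module_def A_RCOSETS_def')

lemma quotient_add:
  assumes "submodule K R M" "x \<in> carrier M" "y \<in> carrier M"
  shows "(K +>\<^bsub>M\<^esub> x) \<oplus>\<^bsub>quotient_module M K\<^esub> (K +>\<^bsub>M\<^esub> y) = K +>\<^bsub>M\<^esub> (x \<oplus>\<^bsub>M\<^esub> y)"
proof -
  interpret K: abelian_subgroup K M by (rule submodule_abelian_subgroup) fact
  show ?thesis using assms(2,3) by (simp add: quotient_module_def K.a_rcos_sum)
qed

lemma coset_eq_submodule_iff:
  assumes "submodule K R M" "x \<in> carrier M"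
  shows "K +>\<^bsub>M\<^esub> x = K \<longleftrightarrow> x \<in> K"
proof -
  interpret K: abelian_subgroup K M by (rule submodule_abelian_subgroup) fact
  show ?thesis using K.a_rcos_const K.a_rcos_self assms(2) by metis
qed

lemma hom_factors_through_quotient:
  assumes N: "left_module R N" and K: "submodule K R M"
    and f: "f \<in> left_module_hom R M N" and fK: "\<And>x. x \<in> K \<Longrightarrow> f x = \<zero>\<^bsub>N\<^esub>"
  obtains g where "g \<in> left_module_hom R (quotient_module M K) N"
    and "\<And>x. x \<in> carrier M \<Longrightarrow> g (K +>\<^bsub>M\<^esub> x) = f x"
proof -
  interpret N: left_module R N by fact
  interpret K: abelian_subgroup K M by (rule submodule_abelian_subgroup) fact
  \<comment> \<open>\<open>f\<close> is constant on each coset, so any representative will do.\<close>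
  define g where "g X = f (SOME y. y \<in> X)" for X
  have g: "g (K +>\<^bsub>M\<^esub> x) = f x" if x: "x \<in> carrier M" for x
  proof -
    have "(SOME y. y \<in> K +>\<^bsub>M\<^esub> x) \<in> K +>\<^bsub>M\<^esub> x"
      using K.a_rcos_self[OF x] by (rule someI)
    then obtain k where k: "k \<in> K" "(SOME y. y \<in> K +>\<^bsub>M\<^esub> x) = k \<oplus>\<^bsub>M\<^esub> x"
      by (auto simp: a_r_coset_def r_coset_def)
    then show ?thesis
      using x fK left_module_homD[OF f] K.a_Hcarr by (simp add: g_def)
  qed
  moreover have "g \<in> left_module_hom R (quotient_module M K) N"
    by (rule left_module_homI)
      (auto simp: quotient_carrier_iff quotient_add[OF K] smult_coset[OF K] g left_module_homD[OF f])
  ultimately show thesis using that by blast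
qed

section \<open>Annihilators\<close>

text \<open>
  Right multiples \<open>a r\<close> still annihilate \<open>U\<close> because \<open>U\<close> is closed under \<open>r\<close>.
\<close>

lemma annihilator_ideal:
  assumes U: "submodule U R M"
  shows "ideal (annihilator R M U) R"
proof (rule idealI)
  note UD = submoduleD[OF U] and sub = subsetD[OF submoduleD(1)[OF U]]
  show "ring R" by (rule R.ring_axioms)
  have "annihilator R M U \<noteq> {}"
    using R.zero_closed smult_zero_left sub by (auto simp: annihilator_def)
  then show "subgroup (annihilator R M U) (add_monoid R)"
    by (intro group.subgroupI)
      (auto simp: annihilator_def R.a_group smult_l_distr sub smult_minus_left simp flip: a_inv_def)
  fix a r assume "a \<in> annihilator R M U" "r \<in> carrier R"
  then show "r \<otimes>\<^bsub>R\<^esub> a \<in> annihilator R M U" "a \<otimes>\<^bsub>R\<^esub> r \<in> annihilator R M U"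
    using UD by (auto simp: annihilator_def smult_assoc1 sub smult_zero_right)
qed

lemma Ann_quotient_iff:
  assumes K: "submodule K R M"
  shows "r \<in> Ann R (quotient_module M K) \<longleftrightarrow> r \<in> carrier R \<and> (\<forall>x\<in>carrier M. r \<odot>\<^bsub>M\<^esub> x \<in> K)"
proof -
  have "\<zero>\<^bsub>quotient_module M K\<^esub> = K" by (simp add: quotient_module_def)
  moreover have "r \<odot>\<^bsub>quotient_module M K\<^esub> (K +>\<^bsub>M\<^esub> x) = K \<longleftrightarrow> r \<odot>\<^bsub>M\<^esub> x \<in> K"
    if "r \<in> carrier R" "x \<in> carrier M" for x
    using that by (simp add: smult_coset[OF K] coset_eq_submodule_iff[OF K])
  ultimately show ?thesis
    unfolding annihilator_def mem_Collect_eq Ball_def quotient_carrier_iff by metis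
qed

lemma Ann_quotient_ideal:
  assumes K: "submodule K R M"
  shows "ideal (Ann R (quotient_module M K)) R"
proof -
  interpret Q: left_module R "quotient_module M K" using K by (rule quotient_left_module)
  show ?thesis using Q.submodule_carrier by (rule Q.annihilator_ideal)
qed

section \<open>The submodule \<open>I M\<close>\<close>

lemma zero_mem_ideal_smult: "\<zero>\<^bsub>M\<^esub> \<in> ideal_smult I M"
  unfolding ideal_smult_def by (rule CollectI, rule exI[of _ 0]) auto

text \<open>
  The set \<open>I M\<close> arises from zero by repeatedly adding one product \<open>a x\<close>. Working with this step and
  the matching induction rule avoids concatenating indexed sums.
\<close>

lemma ideal_smult_step:
  assumes I: "I \<subseteq> carrier R" and "y \<in> ideal_smult I M" "a \<in> I" "x \<in> carrier M"
  shows "a \<odot>\<^bsub>M\<^esub> x \<oplus>\<^bsub>M\<^esub> y \<in> ideal_smult I M"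
proof -
  obtain n :: nat and b z where y: "y = (\<Oplus>\<^bsub>M\<^esub>k\<in>{..<n}. b k \<odot>\<^bsub>M\<^esub> z k)"
    and b: "b \<in> {..<n} \<rightarrow> I" and z: "z \<in> {..<n} \<rightarrow> carrier M"
    using assms(2) by (auto simp: ideal_smult_def)
  let ?b = "b(n := a)" and ?z = "z(n := x)"
  have cl: "(\<lambda>k. ?b k \<odot>\<^bsub>M\<^esub> ?z k) \<in> {..<n} \<rightarrow> carrier M" "(\<lambda>k. b k \<odot>\<^bsub>M\<^esub> z k) \<in> {..<n} \<rightarrow> carrier M"
    using subsetD[OF I] b z assms(3,4) by (auto simp: Pi_iff)
  have "(\<Oplus>\<^bsub>M\<^esub>k\<in>{..<Suc n}. ?b k \<odot>\<^bsub>M\<^esub> ?z k)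
      = ?b n \<odot>\<^bsub>M\<^esub> ?z n \<oplus>\<^bsub>M\<^esub> (\<Oplus>\<^bsub>M\<^esub>k\<in>{..<n}. ?b k \<odot>\<^bsub>M\<^esub> ?z k)"
    unfolding lessThan_Suc using cl(1) assms(3,4) I by (intro M.finsum_insert) auto
  also have "(\<Oplus>\<^bsub>M\<^esub>k\<in>{..<n}. ?b k \<odot>\<^bsub>M\<^esub> ?z k) = y"
    unfolding y using cl(2) by (intro M.finsum_cong') auto
  finally have "a \<odot>\<^bsub>M\<^esub> x \<oplus>\<^bsub>M\<^esub> y = (\<Oplus>\<^bsub>M\<^esub>k\<in>{..<Suc n}. ?b k \<odot>\<^bsub>M\<^esub> ?z k)" by simp
  moreover have "?b \<in> {..<Suc n} \<rightarrow> I" "?z \<in> {..<Suc n} \<rightarrow> carrier M"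
    using b z assms(3,4) by (auto simp: less_Suc_eq)
  ultimately show ?thesis unfolding ideal_smult_def by blast
qed

lemma ideal_smult_induct [consumes 2, case_names zero step]:
  assumes I: "I \<subseteq> carrier R" and "y \<in> ideal_smult I M"
    and zero: "P \<zero>\<^bsub>M\<^esub>"
    and step: "\<And>a x z. a \<in> I \<Longrightarrow> x \<in> carrier M \<Longrightarrow> z \<in> carrier M \<Longrightarrow> P z \<Longrightarrow> P (a \<odot>\<^bsub>M\<^esub> x \<oplus>\<^bsub>M\<^esub> z)"
  shows "P y"
proof -
  have "P (\<Oplus>\<^bsub>M\<^esub>k\<in>{..<n}. b k \<odot>\<^bsub>M\<^esub> z k)"
    if "b \<in> {..<n} \<rightarrow> I" "z \<in> {..<n} \<rightarrow> carrier M" for n :: nat and b z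
    using that
  proof (induction n)
    case 0
    then show ?case using zero by simp
  next
    case (Suc n)
    then have *: "b \<in> {..<n} \<rightarrow> I" "z \<in> {..<n} \<rightarrow> carrier M" "b n \<in> I" "z n \<in> carrier M" by auto
    then have cl: "(\<lambda>k. b k \<odot>\<^bsub>M\<^esub> z k) \<in> {..<n} \<rightarrow> carrier M" using I by auto
    then have "(\<Oplus>\<^bsub>M\<^esub>k\<in>{..<Suc n}. b k \<odot>\<^bsub>M\<^esub> z k)
        = b n \<odot>\<^bsub>M\<^esub> z n \<oplus>\<^bsub>M\<^esub> (\<Oplus>\<^bsub>M\<^esub>k\<in>{..<n}. b k \<odot>\<^bsub>M\<^esub> z k)"
      unfolding lessThan_Suc using * I by (intro M.finsum_insert) auto
    then show ?case using step[OF *(3,4) _ Suc.IH[OF *(1,2)]] cl M.finsum_closed by simp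
  qed
  then show ?thesis using assms(2) by (auto simp: ideal_smult_def)
qed

lemma smult_mem_ideal_smult:
  assumes "I \<subseteq> carrier R" "a \<in> I" "x \<in> carrier M"
  shows "a \<odot>\<^bsub>M\<^esub> x \<in> ideal_smult I M"
  using ideal_smult_step[OF assms(1) zero_mem_ideal_smult assms(2,3)] assms by auto

lemma ideal_smult_subset:
  assumes "I \<subseteq> carrier R" "submodule U R M"
    and "\<And>a x. a \<in> I \<Longrightarrow> x \<in> carrier M \<Longrightarrow> a \<odot>\<^bsub>M\<^esub> x \<in> U"
  shows "ideal_smult I M \<subseteq> U"
proof
  fix y assume "y \<in> ideal_smult I M"
  with assms(1) show "y \<in> U"
    by (induction rule: ideal_smult_induct) (auto intro: submoduleD(2,3)[OF assms(2)] assms(3))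
qed

lemma ideal_smult_submodule:
  assumes "left_ideal I R"
  shows "submodule (ideal_smult I M) R M"
proof (rule submodule_intro)
  have I: "I \<subseteq> carrier R"
    using assms by (auto simp: left_ideal_def dest: additive_subgroup.a_subset)
  show sub: "ideal_smult I M \<subseteq> carrier M"
    using I submodule_carrier by (rule ideal_smult_subset) (use I in auto)
  show "\<zero>\<^bsub>M\<^esub> \<in> ideal_smult I M" by (rule zero_mem_ideal_smult)
  show "x \<oplus>\<^bsub>M\<^esub> y \<in> ideal_smult I M" if "x \<in> ideal_smult I M" and y: "y \<in> ideal_smult I M" for x y
    using I that(1)
  proof (induction rule: ideal_smult_induct)
    case zero
    then show ?case using y sub by auto
  next
    case (step a x z)
    then have "a \<odot>\<^bsub>M\<^esub> x \<oplus>\<^bsub>M\<^esub> z \<oplus>\<^bsub>M\<^esub> y = a \<odot>\<^bsub>M\<^esub> x \<oplus>\<^bsub>M\<^esub> (z \<oplus>\<^bsub>M\<^esub> y)"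
      using I sub y by (intro M.a_assoc) auto
    then show ?case using step ideal_smult_step[OF I] by simp
  qed
  show "r \<odot>\<^bsub>M\<^esub> x \<in> ideal_smult I M" if r: "r \<in> carrier R" and "x \<in> ideal_smult I M" for r x
    using I that(2)
  proof (induction rule: ideal_smult_induct)
    case zero
    then show ?case using r smult_zero_right zero_mem_ideal_smult by simp
  next
    case (step a x z)
    have aR: "a \<in> carrier R" using step I by auto
    have "r \<otimes>\<^bsub>R\<^esub> a \<in> I" using assms r step by (auto simp: left_ideal_def)
    then have "(r \<otimes>\<^bsub>R\<^esub> a) \<odot>\<^bsub>M\<^esub> x \<oplus>\<^bsub>M\<^esub> r \<odot>\<^bsub>M\<^esub> z \<in> ideal_smult I M"
      using step by (intro ideal_smult_step[OF I]) auto
    then show ?case using aR r step by (simp add: smult_r_distr smult_assoc1)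
  qed
qed

lemma ideal_smult_fully_invariant:
  assumes "left_ideal I R"
  shows "fully_invariant R M (ideal_smult I M)"
  unfolding fully_invariant_def
proof (intro conjI ballI)
  show sub: "submodule (ideal_smult I M) R M" using assms by (rule ideal_smult_submodule)
  have I: "I \<subseteq> carrier R"
    using assms by (auto simp: left_ideal_def dest: additive_subgroup.a_subset)
  fix f assume f: "f \<in> left_module_End R M"
  \<comment> \<open>The preimage of \<open>I M\<close> under \<open>f\<close> contains every product \<open>a x\<close>, since \<open>f (a x) = a (f x)\<close>.\<close>
  have "ideal_smult I M \<subseteq> {x \<in> carrier M. f x \<in> ideal_smult I M}"
    using I by (rule ideal_smult_subset)
      (use I smult_mem_ideal_smult[OF I] in
        \<open>auto intro!: submodule_preimage[OF left_module_axioms f sub] simp: subset_iff left_module_homD[OF f]\<close>)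
  then show "f ` ideal_smult I M \<subseteq> ideal_smult I M" by blast
qed

section \<open>The trace of one module in another\<close>

text \<open>
  This is the sum of all images of \<open>N\<close> in \<open>M\<close>. Describing it as an intersection
  makes full invariance immediate; the description by finite sums is only needed to see that \<open>N\<close>
  generates \<open>M\<close> as soon as the trace is all of \<open>M\<close>.
\<close>

definition trace where
  "trace N = \<Inter>{U. submodule U R M \<and> (\<forall>f\<in>left_module_hom R N M. f ` carrier N \<subseteq> U)}"

lemma trace_submodule: "submodule (trace N) R M"
  unfolding trace_def
  by (rule submodule_Inter) (auto intro: submodule_carrier simp: left_module_homD(1))

lemma hom_image_subset_trace:
  "f \<in> left_module_hom R N M \<Longrightarrow> x \<in> carrier N \<Longrightarrow> f x \<in> trace N"
  by (auto simp: trace_def)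

lemma trace_minimal:
  assumes "submodule U R M" "\<And>f x. f \<in> left_module_hom R N M \<Longrightarrow> x \<in> carrier N \<Longrightarrow> f x \<in> U"
  shows "trace N \<subseteq> U"
  using assms by (auto simp: trace_def)

text \<open>
  For an endomorphism \<open>g\<close>, the preimage of the trace under \<open>g\<close> contains every image of \<open>N\<close>, because
  \<open>g \<circ> f\<close> is again a homomorphism from \<open>N\<close>.
\<close>

lemma trace_fully_invariant: "fully_invariant R M (trace N)"
  unfolding fully_invariant_def
proof (intro conjI ballI trace_submodule)
  fix g assume g: "g \<in> left_module_End R M"
  have "g (f x) \<in> trace N" if "f \<in> left_module_hom R N M" "x \<in> carrier N" for f x
    using hom_image_subset_trace[OF left_module_hom_comp[OF that(1) g] that(2)] by simp
  then have "trace N \<subseteq> {x \<in> carrier M. g x \<in> trace N}"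
    by (intro trace_minimal submodule_preimage[OF left_module_axioms g trace_submodule])
      (auto simp: left_module_homD(1))
  then show "g ` trace N \<subseteq> trace N" by blast
qed

text \<open>
  The supports of \<open>f\<close> and \<open>r f\<close> may differ, so both sums are compared over the support of \<open>f\<close>.
\<close>

lemma smult_gfinprod:
  assumes r: "r \<in> carrier R" and f: "f \<in> A \<rightarrow> carrier M"
    and fin: "finite {i \<in> A. f i \<noteq> \<zero>\<^bsub>M\<^esub>}"
  shows "gfinprod (add_monoid M) (\<lambda>i. r \<odot>\<^bsub>M\<^esub> f i) A = r \<odot>\<^bsub>M\<^esub> gfinprod (add_monoid M) f A"
proof -
  let ?S = "{i \<in> A. f i \<noteq> \<zero>\<^bsub>M\<^esub>}"
  have fin_smult: "(\<lambda>i. r \<odot>\<^bsub>M\<^esub> f i) \<in> B \<rightarrow> carrier M" if "B \<subseteq> A" for B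
    using f r that by auto
  have sum: "(\<Oplus>\<^bsub>M\<^esub>i\<in>B. r \<odot>\<^bsub>M\<^esub> f i) = r \<odot>\<^bsub>M\<^esub> (\<Oplus>\<^bsub>M\<^esub>i\<in>B. f i)" if "finite B" "B \<subseteq> A" for B
    using that
  proof (induction B)
    case empty
    then show ?case using r by (simp add: smult_zero_right)
  next
    case (insert b B)
    have "f b \<in> carrier M" "f \<in> B \<rightarrow> carrier M" using insert.prems f by auto
    then show ?case using insert r fin_smult[of B] M.finsum_closed[of f B]
      by (simp add: smult_r_distr)
  qed
  have "gfinprod (add_monoid M) (\<lambda>i. r \<odot>\<^bsub>M\<^esub> f i) A = gfinprod (add_monoid M) (\<lambda>i. r \<odot>\<^bsub>M\<^esub> f i) ?S"
    using fin_smult[of A] r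
    by (intro M.add.gfinprod_mono_neutral_cong_right) (auto simp: smult_zero_right)
  also have "\<dots> = (\<Oplus>\<^bsub>M\<^esub>i\<in>?S. r \<odot>\<^bsub>M\<^esub> f i)"
    using M.add.gfinprod_eq_finprod[OF fin, of "\<lambda>i. r \<odot>\<^bsub>M\<^esub> f i"] fin_smult[of ?S]
    by (simp add: finsum_def)
  also have "\<dots> = r \<odot>\<^bsub>M\<^esub> gfinprod (add_monoid M) f A"
    using sum[OF fin] fin by (simp add: gfinprod_def finsum_def)
  finally show ?thesis .
qed

text \<open>
  The index set consists of all homomorphisms \<open>N \<rightarrow> M\<close>, and a family \<open>x\<close> of finite support is sent to
  the sum of the values \<open>f (x f)\<close>. The image is a submodule that contains every image of \<open>N\<close>.
\<close>

lemma generated_by_if_trace: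
  assumes N: "left_module R N" and tr: "trace N = carrier M"
  shows "generated_by R N M"
proof -
  interpret N: left_module R N by fact
  define H where "H = left_module_hom R N M"
  define D where "D = direct_power H N"
  define s where "s x = gfinprod (add_monoid M) (\<lambda>f. f (x f)) H" for x
  note HD = left_module_homD[of _ R N M, folded H_def]
  have H0: "f \<zero>\<^bsub>N\<^esub> = \<zero>\<^bsub>M\<^esub>" if "f \<in> H" for f
    using that unfolding H_def by (rule left_module_hom_zero[OF N left_module_axioms])
  have grp: "group (add_monoid N)" by (rule N.M.a_group)
  have carrier_sum: "carrier (sum_group H (\<lambda>_. add_monoid N)) = carrier D"
    by (simp add: carrier_sum_group grp D_def direct_power_def)
  have D_iff: "x \<in> carrier D \<longleftrightarrow> x \<in> H \<rightarrow>\<^sub>E carrier N \<and> finite {f \<in> H. x f \<noteq> \<zero>\<^bsub>N\<^esub>}" for x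
    by (simp add: D_def direct_power_def)
  have Dops: "x \<oplus>\<^bsub>D\<^esub> y = x \<otimes>\<^bsub>sum_group H (\<lambda>_. add_monoid N)\<^esub> y" "r \<odot>\<^bsub>D\<^esub> x = (\<lambda>f\<in>H. r \<odot>\<^bsub>N\<^esub> x f)"
    for x y r by (simp_all add: D_def direct_power_def)
  interpret S: group "sum_group H (\<lambda>_. add_monoid N)" by (rule sum_group) (rule grp)
  have D_add: "x \<oplus>\<^bsub>D\<^esub> y \<in> carrier D" if "x \<in> carrier D" "y \<in> carrier D" for x y
    using that S.m_closed[of x y] unfolding carrier_sum Dops by blast
  have D_smult: "r \<odot>\<^bsub>D\<^esub> x \<in> carrier D" if r: "r \<in> carrier R" and x: "x \<in> carrier D" for r x
  proof -
    have "{f \<in> H. (r \<odot>\<^bsub>D\<^esub> x) f \<noteq> \<zero>\<^bsub>N\<^esub>} \<subseteq> {f \<in> H. x f \<noteq> \<zero>\<^bsub>N\<^esub>}"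
      using r by (auto simp: Dops N.smult_zero_right)
    then have "finite {f \<in> H. (r \<odot>\<^bsub>D\<^esub> x) f \<noteq> \<zero>\<^bsub>N\<^esub>}"
      by (rule finite_subset) (use x in \<open>simp add: D_iff\<close>)
    moreover have "r \<odot>\<^bsub>D\<^esub> x \<in> H \<rightarrow>\<^sub>E carrier N" using x r by (auto simp: D_iff Dops)
    ultimately show ?thesis by (simp add: D_iff)
  qed
  have "s \<in> hom (sum_group H (\<lambda>_. add_monoid N)) (add_monoid M)"
    unfolding s_def
    by (rule comm_group.hom_group_sum) (auto simp: M.a_comm_group grp H_def left_module_hom_def)
  then have s_closed: "s x \<in> carrier M" and s_add: "y \<in> carrier D \<Longrightarrow> s (x \<oplus>\<^bsub>D\<^esub> y) = s x \<oplus>\<^bsub>M\<^esub> s y"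
    if "x \<in> carrier D" for x y
    using that unfolding hom_def carrier_sum Dops by auto
  have s_smult: "s (r \<odot>\<^bsub>D\<^esub> x) = r \<odot>\<^bsub>M\<^esub> s x" if r: "r \<in> carrier R" and x: "x \<in> carrier D" for r x
  proof -
    have val: "(\<lambda>f. f (y f)) \<in> H \<rightarrow> carrier M" if "y \<in> carrier D" for y
      using that HD(1) by (auto simp: D_iff)
    have "{f \<in> H. f (x f) \<noteq> \<zero>\<^bsub>M\<^esub>} \<subseteq> {f \<in> H. x f \<noteq> \<zero>\<^bsub>N\<^esub>}" using H0 by auto
    then have fin: "finite {f \<in> H. f (x f) \<noteq> \<zero>\<^bsub>M\<^esub>}"
      by (rule finite_subset) (use x in \<open>simp add: D_iff\<close>)
    have "f ((r \<odot>\<^bsub>D\<^esub> x) f) = r \<odot>\<^bsub>M\<^esub> f (x f)" if "f \<in> H" for f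
      using that x r HD(3)[OF that r, of "x f"] by (auto simp: D_iff Dops)
    then have "s (r \<odot>\<^bsub>D\<^esub> x) = gfinprod (add_monoid M) (\<lambda>f. r \<odot>\<^bsub>M\<^esub> f (x f)) H"
      unfolding s_def using val[OF D_smult[OF r x]]
      by (intro M.add.gfinprod_cong) (simp_all only: simp_implies_def)
    then show ?thesis using smult_gfinprod[OF r val[OF x] fin] by (simp add: s_def)
  qed
  have s_hom: "s \<in> left_module_hom R D M"
    by (rule left_module_homI) (simp_all add: s_closed s_add s_smult)
  have image: "f n \<in> s ` carrier D" if f: "f \<in> H" and n: "n \<in> carrier N" for f n
  proof
    \<comment> \<open>the family concentrated at the index \<open>f\<close>\<close>
    let ?e = "\<lambda>g\<in>H. if g = f then n else \<zero>\<^bsub>N\<^esub>"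
    have "{g \<in> H. ?e g \<noteq> \<zero>\<^bsub>N\<^esub>} \<subseteq> {f}" by auto
    then have "finite {g \<in> H. ?e g \<noteq> \<zero>\<^bsub>N\<^esub>}" by (rule finite_subset) simp
    then show "?e \<in> carrier D" using n by (auto simp: D_iff)
    have "s ?e = gfinprod (add_monoid M) (\<lambda>g. g (?e g)) {f}"
      unfolding s_def
    proof (rule M.add.gfinprod_mono_neutral_cong_right)
      show "g (?e g) = \<zero>\<^bsub>M\<^esub>" if "g \<in> H - {f}" for g
        using that H0[of g] by simp
      show "(\<lambda>g. g (?e g)) \<in> H \<rightarrow> carrier M"
        using n HD(1) by simp
    qed (use f in simp_all)
    also have "\<dots> = f n" using f n HD(1)[OF f n] by (simp add: Pi_def)
    finally show "f n = s ?e" by simp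
  qed
  \<comment> \<open>\<open>s 0 = 0\<close> follows from \<open>0 = 0 \<cdot> 0\<close> without building a module structure on the direct sum.\<close>
  have zero_D: "(\<lambda>f\<in>H. \<zero>\<^bsub>N\<^esub>) \<in> carrier D" by (auto simp: D_iff)
  have "s (\<zero>\<^bsub>R\<^esub> \<odot>\<^bsub>D\<^esub> (\<lambda>f\<in>H. \<zero>\<^bsub>N\<^esub>)) = \<zero>\<^bsub>M\<^esub>"
    using s_smult[OF R.zero_closed zero_D] smult_zero_left s_closed[OF zero_D] by simp
  then have "\<zero>\<^bsub>M\<^esub> \<in> s ` carrier D" using D_smult[OF R.zero_closed zero_D] by (metis image_eqI)
  then have "submodule (s ` carrier D) R M"
  proof (rule submodule_intro[rotated])
    show "x \<oplus>\<^bsub>M\<^esub> y \<in> s ` carrier D" if "x \<in> s ` carrier D" "y \<in> s ` carrier D" for x y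
      using that D_add s_add by (metis (no_types, lifting) imageE imageI)
    show "r \<odot>\<^bsub>M\<^esub> x \<in> s ` carrier D" if "r \<in> carrier R" "x \<in> s ` carrier D" for r x
      using that D_smult s_smult by (metis (no_types, lifting) imageE imageI)
  qed (use s_closed in auto)
  then have "trace N \<subseteq> s ` carrier D" using image by (intro trace_minimal) (auto simp: H_def)
  then have "s ` carrier D = carrier M" using tr s_closed by auto
  then show ?thesis unfolding generated_by_def using s_hom unfolding D_def by blast
qed

section \<open>The implications between the conditions\<close>

lemma proper_fully_invariantD:
  assumes "proper_fully_invariant R M K"
  shows "submodule K R M" "K \<subseteq> carrier M" "K \<noteq> carrier M"
  using assms submoduleD(1)[of K R M] by (auto simp: proper_fully_invariant_def fully_invariant_def)

text \<open>
  Only one inclusion needs to be checked: what annihilates \<open>M\<close> annihilates every quotient.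
\<close>

lemma coprimeI:
  assumes "\<And>K r. proper_fully_invariant R M K \<Longrightarrow> r \<in> Ann R (quotient_module M K) \<Longrightarrow> r \<in> Ann R M"
  shows "coprime_module R M"
  unfolding coprime_module_def
proof (intro allI impI subset_antisym)
  fix K assume K: "proper_fully_invariant R M K"
  then have sub: "submodule K R M" by (rule proper_fully_invariantD)
  show "Ann R (quotient_module M K) \<subseteq> Ann R M" using assms[OF K] by blast
  show "Ann R M \<subseteq> Ann R (quotient_module M K)"
    using submoduleD(2)[OF sub] by (auto simp: Ann_quotient_iff[OF sub]) (auto simp: annihilator_def)
qed

lemma left_ideal_if_ideal: "ideal I R \<Longrightarrow> left_ideal I R"
  by (auto simp: left_ideal_def ideal.axioms(1) ideal.I_l_closed)

lemma ideal_smult_eq_zero_iff: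
  assumes "I \<subseteq> carrier R"
  shows "ideal_smult I M = {\<zero>\<^bsub>M\<^esub>} \<longleftrightarrow> I \<subseteq> Ann R M"
proof
  assume "ideal_smult I M = {\<zero>\<^bsub>M\<^esub>}"
  then show "I \<subseteq> Ann R M"
    using smult_mem_ideal_smult[OF assms] assms by (auto simp: annihilator_def)
next
  assume I: "I \<subseteq> Ann R M"
  have "submodule {\<zero>\<^bsub>M\<^esub>} R M" by (rule submodule_intro) (auto simp: smult_zero_right)
  with assms have "ideal_smult I M \<subseteq> {\<zero>\<^bsub>M\<^esub>}"
    by (rule ideal_smult_subset) (use I in \<open>auto simp: annihilator_def\<close>)
  then show "ideal_smult I M = {\<zero>\<^bsub>M\<^esub>}" using zero_mem_ideal_smult by blast
qed

text \<open>
  \<open>I M\<close> is fully invariant and \<open>I\<close> annihilates \<open>M/I M\<close>, so a proper \<open>I M\<close> puts \<open>I\<close> into \<open>Ann(M)\<close>.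
\<close>

lemma coprime_imp_ideal_smult:
  assumes "coprime_module R M" "left_ideal I R"
  shows "I \<subseteq> Ann R M \<or> ideal_smult I M = carrier M"
proof (rule disjCI)
  assume "ideal_smult I M \<noteq> carrier M"
  then have K: "proper_fully_invariant R M (ideal_smult I M)"
    using ideal_smult_fully_invariant[OF assms(2)] by (simp add: proper_fully_invariant_def)
  have I: "I \<subseteq> carrier R"
    using assms(2) by (auto simp: left_ideal_def dest: additive_subgroup.a_subset)
  have "I \<subseteq> Ann R (quotient_module M (ideal_smult I M))"
    using I smult_mem_ideal_smult[OF I] by (auto simp: Ann_quotient_iff[OF ideal_smult_submodule[OF assms(2)]])
  then show "I \<subseteq> Ann R M" using assms(1) K by (simp add: coprime_module_def)
qed

text \<open>
  For the converse, \<open>Ann(M/K) M\<close> lies in the proper submodule \<open>K\<close>, so by the dichotomy it vanishes.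
\<close>

lemma coprime_iff_ideal_smult:
  "coprime_module R M \<longleftrightarrow>
    (\<forall>I. left_ideal I R \<longrightarrow> ideal_smult I M = {\<zero>\<^bsub>M\<^esub>} \<or> ideal_smult I M = carrier M)"
    (is "_ \<longleftrightarrow> ?d")
proof
  assume "coprime_module R M"
  then show ?d
    using coprime_imp_ideal_smult ideal_smult_eq_zero_iff
    by (metis additive_subgroup.a_subset left_ideal_def)
next
  assume d: ?d
  show "coprime_module R M"
  proof (rule coprimeI)
    fix K r assume K: "proper_fully_invariant R M K" and r: "r \<in> Ann R (quotient_module M K)"
    note KD = proper_fully_invariantD[OF K]
    let ?I = "Ann R (quotient_module M K)"
    have I: "?I \<subseteq> carrier R" by (auto simp: annihilator_def)
    have "ideal_smult ?I M \<subseteq> K"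
      using I KD(1) by (rule ideal_smult_subset) (auto simp: Ann_quotient_iff[OF KD(1)])
    then have "ideal_smult ?I M \<noteq> carrier M" using KD by blast
    then have "ideal_smult ?I M = {\<zero>\<^bsub>M\<^esub>}"
      using d left_ideal_if_ideal[OF Ann_quotient_ideal[OF KD(1)]] by blast
    then show "r \<in> Ann R M" using ideal_smult_eq_zero_iff[OF I] r by blast
  qed
qed

text \<open>
  Let \<open>I J \<subseteq> Ann(M)\<close>. If \<open>J\<close> is not contained in \<open>Ann(M)\<close>, then \<open>J M = M\<close> by coprimeness, and
  \<open>I M = I (J M) = 0\<close>.
\<close>

lemma coprime_imp_prime_Ann:
  assumes cop: "coprime_module R M" and nz: "carrier M \<noteq> {\<zero>\<^bsub>M\<^esub>}"
  shows "prime_ideal (Ann R M) R"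
  unfolding prime_ideal_def
proof (intro conjI allI impI)
  show "ideal (Ann R M) R" by (rule annihilator_ideal[OF submodule_carrier])
  obtain x where "x \<in> carrier M" "x \<noteq> \<zero>\<^bsub>M\<^esub>" using nz by blast
  then have "\<one>\<^bsub>R\<^esub> \<notin> Ann R M" by (auto simp: annihilator_def)
  then show "Ann R M \<noteq> carrier R" by auto
  fix I J assume I: "ideal I R" and J: "ideal J R" and IJ: "I \<cdot>\<^bsub>R\<^esub> J \<subseteq> Ann R M"
  interpret I: ideal I R by fact
  interpret J: ideal J R by fact
  show "I \<subseteq> Ann R M \<or> J \<subseteq> Ann R M"
  proof (rule disjCI)
    assume "\<not> J \<subseteq> Ann R M"
    then have JM: "ideal_smult J M = carrier M"
      using coprime_imp_ideal_smult[OF cop left_ideal_if_ideal[OF J]] by blast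
    have "a \<odot>\<^bsub>M\<^esub> y = \<zero>\<^bsub>M\<^esub>" if a: "a \<in> I" and "y \<in> ideal_smult J M" for a y
      using J.a_subset that(2)
    proof (induction rule: ideal_smult_induct)
      case zero
      then show ?case using a I.a_Hcarr smult_zero_right by blast
    next
      case (step b x z)
      have "a \<otimes>\<^bsub>R\<^esub> b \<in> Ann R M" using a step IJ by (auto intro: ideal_prod.prod)
      then have "(a \<otimes>\<^bsub>R\<^esub> b) \<odot>\<^bsub>M\<^esub> x = \<zero>\<^bsub>M\<^esub>" using step by (auto simp: annihilator_def)
      then show ?case
        using step a I.a_Hcarr J.a_Hcarr by (simp add: smult_r_distr smult_assoc1)
    qed
    then show "I \<subseteq> Ann R M" using JM I.a_subset by (auto simp: annihilator_def)
  qed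
qed

text \<open>
  Here \<open>(\<ast>\<ast>)\<close> enters: for a proper fully invariant \<open>K\<close>, the product \<open>Ann(K) Ann(M/K)\<close> annihilates
  \<open>M\<close>, since \<open>Ann(M/K)\<close> maps \<open>M\<close> into \<open>K\<close>; and the first factor is not contained in \<open>Ann(M)\<close>.
\<close>

lemma prime_Ann_imp_coprime:
  assumes star: "\<And>K. proper_fully_invariant R M K \<Longrightarrow> \<not> annihilator R M K \<subseteq> Ann R M"
    and prime: "prime_ideal (Ann R M) R"
  shows "coprime_module R M"
proof (rule coprimeI)
  fix K r assume K: "proper_fully_invariant R M K" and r: "r \<in> Ann R (quotient_module M K)"
  note KD = proper_fully_invariantD[OF K]
  have "u \<in> Ann R M" if "u \<in> annihilator R M K \<cdot>\<^bsub>R\<^esub> Ann R (quotient_module M K)" for u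
    using that
  proof induction
    case (prod i j)
    then have "j \<in> carrier R" "\<And>x. x \<in> carrier M \<Longrightarrow> j \<odot>\<^bsub>M\<^esub> x \<in> K"
      by (simp_all add: Ann_quotient_iff[OF KD(1)])
    with prod(1) show ?case by (simp add: annihilator_def smult_assoc1)
  qed (auto simp: annihilator_def smult_l_distr)
  then have "annihilator R M K \<cdot>\<^bsub>R\<^esub> Ann R (quotient_module M K) \<subseteq> Ann R M" by (rule subsetI)
  then have "annihilator R M K \<subseteq> Ann R M \<or> Ann R (quotient_module M K) \<subseteq> Ann R M"
    using prime annihilator_ideal[OF KD(1)] Ann_quotient_ideal[OF KD(1)]
    by (simp add: prime_ideal_def)
  then show "r \<in> Ann R M" using star[OF K] subsetD[OF _ r] by metis
qed

text \<open>
  Let \<open>f M \<subseteq> K\<close> and \<open>L = Ann(K)\<close>. By \<open>(\<ast>\<ast>)\<close> and coprimeness \<open>L M = M\<close>, hence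
  \<open>f M = f (L M) = L (f M) \<subseteq> L K = 0\<close>.
\<close>

lemma coprime_imp_endo_coprime:
  assumes star: "\<And>K. proper_fully_invariant R M K \<Longrightarrow> \<not> annihilator R M K \<subseteq> Ann R M"
    and cop: "coprime_module R M"
  shows "endo_coprime R M"
  unfolding endo_coprime_def
proof (intro allI impI ballI)
  fix K f x
  assume K: "proper_fully_invariant R M K" and f: "f \<in> left_module_End R M"
    and fM: "f ` carrier M \<subseteq> K" and x: "x \<in> carrier M"
  note KD = proper_fully_invariantD[OF K]
  let ?L = "annihilator R M K"
  have L: "?L \<subseteq> carrier R" by (auto simp: annihilator_def)
  have "ideal_smult ?L M = carrier M"
    using coprime_imp_ideal_smult[OF cop left_ideal_if_ideal[OF annihilator_ideal[OF KD(1)]]] star[OF K]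
    by blast
  with x have "x \<in> ideal_smult ?L M" by simp
  with L show "f x = \<zero>\<^bsub>M\<^esub>"
  proof (induction rule: ideal_smult_induct)
    case zero
    then show ?case by (rule left_module_hom_zero[OF left_module_axioms left_module_axioms f])
  next
    case (step a y z)
    then have "a \<in> carrier R" "a \<odot>\<^bsub>M\<^esub> f y = \<zero>\<^bsub>M\<^esub>" using fM by (auto simp: annihilator_def)
    then show ?case using step by (simp add: left_module_homD[OF f])
  qed
qed

text \<open>
  A non-zero endomorphism killing \<open>K\<close> factors through \<open>M/K\<close>, so its image lies in the trace of
  \<open>M/K\<close>. Endo-coprimeness then forbids the trace to be proper.
\<close>

lemma endo_coprime_imp_fully_coprime:
  assumes fi: "fi_coretractable R M" and endo: "endo_coprime R M"
  shows "fully_coprime R M"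
  unfolding fully_coprime_def
proof (intro allI impI)
  fix K assume K: "proper_fully_invariant R M K"
  note KD = proper_fully_invariantD[OF K]
  let ?Q = "quotient_module M K"
  obtain f where f: "f \<in> left_module_End R M" "\<not> (\<forall>x\<in>carrier M. f x = \<zero>\<^bsub>M\<^esub>)" "\<forall>x\<in>K. f x = \<zero>\<^bsub>M\<^esub>"
    using fi K unfolding fi_coretractable_def by blast
  then obtain g where g: "g \<in> left_module_hom R ?Q M"
      "\<And>x. x \<in> carrier M \<Longrightarrow> g (K +>\<^bsub>M\<^esub> x) = f x"
    using hom_factors_through_quotient[OF left_module_axioms KD(1) f(1)] by blast
  have "f x \<in> trace ?Q" if "x \<in> carrier M" for x
    using hom_image_subset_trace[OF g(1), of "K +>\<^bsub>M\<^esub> x"] g(2) that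
    by (auto simp: quotient_carrier_iff)
  then have "\<not> proper_fully_invariant R M (trace ?Q)"
    using f(1,2) endo unfolding endo_coprime_def by blast
  then have "trace ?Q = carrier M"
    using trace_fully_invariant[of ?Q] by (simp add: proper_fully_invariant_def)
  with quotient_left_module[OF KD(1)] show "generated_by R ?Q M" by (rule generated_by_if_trace)
qed

text \<open>
  Whatever annihilates \<open>N\<close> annihilates direct sums of copies of \<open>N\<close> and their homomorphic images.
\<close>

lemma Ann_subset_if_generated_by:
  fixes N :: "('r, 'n, 's) module_scheme"
  assumes N: "left_module R N" and gen: "generated_by R N M"
  shows "Ann R N \<subseteq> Ann R M"
proof
  interpret N: left_module R N by fact
  fix r assume r: "r \<in> Ann R N"
  then have rR: "r \<in> carrier R" by (simp add: annihilator_def)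
  obtain I :: "('n \<Rightarrow> 'm) set" and h where h: "h \<in> left_module_hom R (direct_power I N) M"
    and surj: "h ` carrier (direct_power I N) = carrier M"
    using gen unfolding generated_by_def by blast
  let ?D = "direct_power I N" and ?z = "\<lambda>i\<in>I. \<zero>\<^bsub>N\<^esub>"
  have z: "?z \<in> carrier ?D" by (simp add: direct_power_def)
  have "\<zero>\<^bsub>R\<^esub> \<odot>\<^bsub>?D\<^esub> ?z = ?z"
    by (rule ext) (simp add: direct_power_def N.smult_zero_left)
  then have hz: "h ?z = \<zero>\<^bsub>M\<^esub>"
    using left_module_homD(3)[OF h R.zero_closed z] left_module_homD(1)[OF h z]
    by (simp add: smult_zero_left)
  have "r \<odot>\<^bsub>M\<^esub> h x = \<zero>\<^bsub>M\<^esub>" if x: "x \<in> carrier ?D" for x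
  proof -
    have "r \<odot>\<^bsub>?D\<^esub> x = ?z"
      using r x by (auto simp: direct_power_def annihilator_def fun_eq_iff)
    then show ?thesis using left_module_homD(3)[OF h rR x] hz by simp
  qed
  then show "r \<in> Ann R M" using rR by (auto simp: annihilator_def simp flip: surj)
qed

lemma fully_coprime_imp_coprime:
  assumes "fully_coprime R M"
  shows "coprime_module R M"
  using assms Ann_subset_if_generated_by[OF quotient_left_module[OF proper_fully_invariantD(1)]]
  by (intro coprimeI) (auto simp: fully_coprime_def)

text \<open>
  Over a commutative ring, multiplication by an element of \<open>Ann(K)\<close> outside \<open>Ann(M)\<close> is a non-zero
  endomorphism killing \<open>K\<close>.
\<close>

lemma fi_coretractable_if_commutative:
  assumes star: "\<And>K. proper_fully_invariant R M K \<Longrightarrow> \<not> annihilator R M K \<subseteq> Ann R M"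
    and "cring R"
  shows "fi_coretractable R M"
  unfolding fi_coretractable_def
proof (intro allI impI)
  interpret cring R by fact
  fix K assume "proper_fully_invariant R M K"
  then obtain r where r: "r \<in> annihilator R M K" "r \<notin> Ann R M" using star by blast
  then have rR: "r \<in> carrier R" by (simp add: annihilator_def)
  have "(\<lambda>x. r \<odot>\<^bsub>M\<^esub> x) \<in> left_module_End R M"
    using rR by (intro left_module_homI) (auto simp: smult_r_distr m_comm simp flip: smult_assoc1)
  then show "\<exists>f\<in>left_module_End R M. \<not> (\<forall>x\<in>carrier M. f x = \<zero>\<^bsub>M\<^esub>) \<and> (\<forall>x\<in>K. f x = \<zero>\<^bsub>M\<^esub>)"
    by (rule bexI[rotated]) (use r in \<open>auto simp: annihilator_def\<close>)
qed

end

theorem corollary2p6: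
  fixes R :: "('r, 'p) ring_scheme" and M :: "('r, 'm, 'q) module_scheme"
  assumes "left_module R M"
    and "\<one>\<^bsub>R\<^esub> \<noteq> \<zero>\<^bsub>R\<^esub>"
    and "carrier M \<noteq> {\<zero>\<^bsub>M\<^esub>}"
    and "\<And>K. proper_fully_invariant R M K \<Longrightarrow> \<not> annihilator R M K \<subseteq> Ann R M"
    and "fi_coretractable R M \<or> cring R"
  shows "(coprime_module R M \<longleftrightarrow> endo_coprime R M)
    \<and> (coprime_module R M \<longleftrightarrow> fully_coprime R M)
    \<and> (coprime_module R M \<longleftrightarrow>
        (\<forall>I. left_ideal I R \<longrightarrow> ideal_smult I M = {\<zero>\<^bsub>M\<^esub>} \<or> ideal_smult I M = carrier M))
    \<and> (coprime_module R M \<longleftrightarrow> prime_ideal (Ann R M) R)"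
proof -
  interpret left_module R M by fact
  have fi: "fi_coretractable R M"
    using assms(5) fi_coretractable_if_commutative[OF assms(4)] by blast
  have "coprime_module R M \<Longrightarrow> endo_coprime R M"
    using coprime_imp_endo_coprime[OF assms(4)] by blast
  moreover have "endo_coprime R M \<Longrightarrow> fully_coprime R M"
    by (rule endo_coprime_imp_fully_coprime[OF fi])
  moreover have "fully_coprime R M \<Longrightarrow> coprime_module R M" by (rule fully_coprime_imp_coprime)
  moreover have "coprime_module R M \<longleftrightarrow> prime_ideal (Ann R M) R"
    using coprime_imp_prime_Ann[OF _ assms(3)] prime_Ann_imp_coprime[OF assms(4)] by blast
  ultimately show ?thesis using coprime_iff_ideal_smult by blast
qed

end
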